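(* Let $k$ be a field of characteristic zero, let $d\ge 2$, let $V$ be the space of linear binary forms in $X_0,X_1$ with its standard $\mathrm{SL}_2$-action, and let $W_d=S^dV\otimes V^*\cong S^dV\otimes V$ be the space of pairs $(F_0,F_1)$ of binary forms of degree $d$ with the $\mathrm{SL}_2$-action induced by conjugation of rational maps. There is an isomorphism of $\mathrm{SL}_2$-modules $$\alpha: W_d\xrightarrow{\ \sim\ } S^{d+1}V\oplus S^{d-1}V$$ under which a rational map $\phi=[F_0:F_1]$ given by homogeneous polynomials $F_0(X_0,X_1)$ and $F_1(X_0,X_1)$ of degree $d$ corresponds to the pair of binary forms $(f,g)$, where $g\in S^{d+1}V$ is the fixed point polynomial $$g=X_1F_0(X_0,X_1)-X_0F_1(X_0,X_1)$$ and $f\in S^{d-1}V$ is the divergence $$f=\frac{\partial F_0}{\partial X_0}+\frac{\partial F_1}{\partial X_1}$$ of the map $\mathbb{A}^2\to\mathbb{A}^2$ defined by $(F_0,F_1)$.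
   Context: $S^nV$ denotes the space of homogeneous binary forms of degree $n$ in $X_0,X_1$, on which $\mathrm{SL}_2$ acts by linear substitution of the variables: $\begin{pmatrix}p&q\\ r&s\end{pmatrix}$ sends $X_0\mapsto pX_0+qX_1$, $X_1\mapsto rX_0+sX_1$. The conjugation action on pairs, viewing $F=(F_0,F_1)$ as a polynomial map $\mathbb{A}^2\to\mathbb{A}^2$, is $F\mapsto\gamma^{-1}\circ F\circ\gamma$ for $\gamma\in\mathrm{SL}_2$. A pair $(F_0,F_1)$ corresponds to the element $Y_0F_0(X_0,X_1)+Y_1F_1(X_0,X_1)$ of $S^dV\otimes V$. The pair is written in the order $(f,g)$, with $f$ of degree $d-1$ and $g$ of degree $d+1$. *)

theory Defs
  imports "HOL-Analysis.Analysis" "HOL-Computational_Algebra.Polynomial"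
begin

text \<open>
  Polynomials in $X_0, X_1$ over \<open>'a\<close> are elements of \<open>'a poly poly\<close>: the inner variable is
  $X_0$ and the outer one is $X_1$, so \<open>coeff (coeff P j) i\<close> is the coefficient of
  $X_0^i X_1^j$.  Everything is set up over an arbitrary commutative ring, so that it can be used
  over a field and over every commutative algebra over that field.
\<close>

type_synonym 'a bipoly = "'a poly poly"

definition const :: "'a::comm_ring_1 \<Rightarrow> 'a bipoly" where
  "const a = [:[:a:]:]"

definition X0 :: "'a::comm_ring_1 bipoly" where
  "X0 = [:[:0, 1:]:]"

definition X1 :: "'a::comm_ring_1 bipoly" where
  "X1 = [:0, 1:]"

text \<open>The space $S^nV$.\<close>

definition binary_forms :: "nat \<Rightarrow> 'a::comm_ring_1 bipoly set" where
  "binary_forms n = {P. \<forall>i j. coeff (coeff P j) i \<noteq> 0 \<longrightarrow> i + j = n}"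

text \<open>
  The library's \<open>pderiv\<close> is only available over coefficients without zero divisors, hence the
  following formal derivative; the two agree wherever \<open>pderiv\<close> is defined.
\<close>

definition formal_deriv :: "'a::comm_ring_1 poly \<Rightarrow> 'a poly" where
  "formal_deriv p = (\<Sum>i\<le>degree p. monom (of_nat i * coeff p i) (i - 1))"

lemma formal_deriv_eq_pderiv: "formal_deriv p = pderiv (p :: 'a::idom poly)"
proof -
  have "pderiv p = pderiv (\<Sum>i\<le>degree p. monom (coeff p i) i)"
    by (simp add: poly_as_sum_of_monoms)
  also have "\<dots> = (\<Sum>i\<le>degree p. pderiv (monom (coeff p i) i))"
    by (rule higher_pderiv_sum[of 1, simplified])
  finally show ?thesis
    by (simp add: formal_deriv_def pderiv_monom)
qed

definition partial0 :: "'a::comm_ring_1 bipoly \<Rightarrow> 'a bipoly" where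
  "partial0 P = map_poly formal_deriv P"

definition partial1 :: "'a::comm_ring_1 bipoly \<Rightarrow> 'a bipoly" where
  "partial1 P = formal_deriv P"

lemma partial0_eq_pderiv: "partial0 P = map_poly pderiv (P :: 'a::idom bipoly)"
  by (simp add: partial0_def formal_deriv_eq_pderiv cong: map_poly_cong)

lemma partial1_eq_pderiv: "partial1 P = pderiv (P :: 'a::idom bipoly)"
  by (simp add: partial1_def formal_deriv_eq_pderiv)

text \<open>
  A pair $(F_0, F_1)$ is viewed as a polynomial map of the affine plane.  \<open>subst P G\<close> is
  $P(G_0, G_1)$, that is, $P \circ G$.
\<close>

definition subst :: "'a::comm_ring_1 bipoly \<Rightarrow> 'a bipoly \<times> 'a bipoly \<Rightarrow> 'a bipoly" where
  "subst P G = poly (map_poly (\<lambda>c. poly (map_poly const c) (fst G)) P) (snd G)"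

definition map_comp2 ::
  "'a::comm_ring_1 bipoly \<times> 'a bipoly \<Rightarrow> 'a bipoly \<times> 'a bipoly \<Rightarrow> 'a bipoly \<times> 'a bipoly" where
  "map_comp2 F G = (subst (fst F) G, subst (snd F) G)"

definition linear_map :: "'a::comm_ring_1^2^2 \<Rightarrow> 'a bipoly \<times> 'a bipoly" where
  "linear_map \<gamma> = (const (\<gamma>$1$1) * X0 + const (\<gamma>$1$2) * X1,
                   const (\<gamma>$2$1) * X0 + const (\<gamma>$2$2) * X1)"

definition SL2 :: "('a::comm_ring_1^2^2) set" where
  "SL2 = {\<gamma>. det \<gamma> = 1}"

text \<open>Linear substitution of the variables, on one form and on each component of a pair of forms.\<close>

definition form_act :: "'a::comm_ring_1^2^2 \<Rightarrow> 'a bipoly \<Rightarrow> 'a bipoly" where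
  "form_act \<gamma> P = subst P (linear_map \<gamma>)"

definition sum_act ::
  "'a::comm_ring_1^2^2 \<Rightarrow> 'a bipoly \<times> 'a bipoly \<Rightarrow> 'a bipoly \<times> 'a bipoly" where
  "sum_act \<gamma> = map_prod (form_act \<gamma>) (form_act \<gamma>)"

text \<open>The conjugation $F \mapsto \gamma^{-1} \circ F \circ \gamma$.\<close>

definition conj_act ::
  "'a::comm_ring_1^2^2 \<Rightarrow> 'a bipoly \<times> 'a bipoly \<Rightarrow> 'a bipoly \<times> 'a bipoly" where
  "conj_act \<gamma> F = map_comp2 (linear_map (matrix_inv \<gamma>)) (map_comp2 F (linear_map \<gamma>))"

definition pair_scale :: "'a::comm_ring_1 \<Rightarrow> 'a bipoly \<times> 'a bipoly \<Rightarrow> 'a bipoly \<times> 'a bipoly" where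
  "pair_scale c = map_prod ((*) (const c)) ((*) (const c))"

text \<open>
  A module over $\mathrm{SL}_2(R)$ carried by the \<open>R\<close>-submodule \<open>V\<close> of an ambient \<open>R\<close>-module.
  Substitution and conjugation are contravariant in $\gamma$, so the action is a right action:
  acting by $\gamma\delta$ is acting by $\gamma$ first and by $\delta$ afterwards.
\<close>

definition SL2_module ::
  "('a::comm_ring_1 \<Rightarrow> 'v::ab_group_add \<Rightarrow> 'v) \<Rightarrow> 'v set \<Rightarrow> ('a^2^2 \<Rightarrow> 'v \<Rightarrow> 'v) \<Rightarrow> bool" where
  "SL2_module sc V act \<longleftrightarrow>
     module sc \<and> module.subspace sc V \<and>
     (\<forall>\<gamma>\<in>SL2. \<forall>v\<in>V. act \<gamma> v \<in> V) \<and>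
     (\<forall>\<gamma>\<in>SL2. \<forall>v\<in>V. \<forall>w\<in>V. act \<gamma> (v + w) = act \<gamma> v + act \<gamma> w) \<and>
     (\<forall>\<gamma>\<in>SL2. \<forall>c. \<forall>v\<in>V. act \<gamma> (sc c v) = sc c (act \<gamma> v)) \<and>
     (\<forall>v\<in>V. act (mat 1) v = v) \<and>
     (\<forall>\<gamma>\<in>SL2. \<forall>\<delta>\<in>SL2. \<forall>v\<in>V. act (\<gamma> ** \<delta>) v = act \<delta> (act \<gamma> v))"

definition SL2_module_iso ::
  "('a::comm_ring_1 \<Rightarrow> 'v::ab_group_add \<Rightarrow> 'v) \<Rightarrow> 'v set \<Rightarrow> ('a^2^2 \<Rightarrow> 'v \<Rightarrow> 'v) \<Rightarrow>
   ('a \<Rightarrow> 'w::ab_group_add \<Rightarrow> 'w) \<Rightarrow> 'w set \<Rightarrow> ('a^2^2 \<Rightarrow> 'w \<Rightarrow> 'w) \<Rightarrow> ('v \<Rightarrow> 'w) \<Rightarrow> bool" where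
  "SL2_module_iso scV V actV scW W actW \<alpha> \<longleftrightarrow>
     SL2_module scV V actV \<and> SL2_module scW W actW \<and>
     bij_betw \<alpha> V W \<and>
     (\<forall>v\<in>V. \<forall>w\<in>V. \<alpha> (v + w) = \<alpha> v + \<alpha> w) \<and>
     (\<forall>c. \<forall>v\<in>V. \<alpha> (scV c v) = scW c (\<alpha> v)) \<and>
     (\<forall>\<gamma>\<in>SL2. \<forall>v\<in>V. \<alpha> (actV \<gamma> v) = actW \<gamma> (\<alpha> v))"

text \<open>
  The space $W_d$, and $S^{d-1}V \oplus S^{d+1}V$, the home of the pairs $(f, g)$ in this order.
\<close>

definition W :: "nat \<Rightarrow> ('a::comm_ring_1 bipoly \<times> 'a bipoly) set" where
  "W d = binary_forms d \<times> binary_forms d"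

definition S_sum :: "nat \<Rightarrow> ('a::comm_ring_1 bipoly \<times> 'a bipoly) set" where
  "S_sum d = binary_forms (d - 1) \<times> binary_forms (d + 1)"

text \<open>
  $\mathrm{SL}_2$ is the group scheme over the base field.  Besides an isomorphism over the field
  itself one therefore considers its base change to every commutative algebra over it, which has to
  be compatible with the points of $\mathrm{SL}_2$ in that algebra.  An algebra is given by its
  structure map, a ring homomorphism.
\<close>

definition base_change ::
  "('a::comm_ring_1 \<Rightarrow> 'b::comm_ring_1) \<Rightarrow> 'a bipoly \<times> 'a bipoly \<Rightarrow> 'b bipoly \<times> 'b bipoly" where
  "base_change h = map_prod (map_poly (map_poly h)) (map_poly (map_poly h))"

definition ring_hom1 :: "('a::comm_ring_1 \<Rightarrow> 'b::comm_ring_1) \<Rightarrow> bool" where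
  "ring_hom1 h \<longleftrightarrow> h 1 = 1 \<and> (\<forall>x y. h (x + y) = h x + h y) \<and> (\<forall>x y. h (x * y) = h x * h y)"

end

theory Submission
  imports Defs
begin

text \<open>
  Both components of the map $(F_0, F_1) \mapsto (f, g)$ have an invariant meaning.  The divergence
  is the trace of the Jacobian matrix; by the chain rule the Jacobian of $\gamma^{-1} \circ F \circ
  \gamma$ is $\gamma^{-1} \cdot (DF \circ \gamma) \cdot \gamma$, whose trace is $f \circ \gamma$.
  The fixed point polynomial is the determinant of the matrix with columns $F$ and $X$; since
  $X = \gamma^{-1} (\gamma X)$, conjugating $F$ changes it into $\det(\gamma^{-1}) \cdot
  (g \circ \gamma)$.  So the map is equivariant for every $\gamma$ of determinant $1$, over any
  commutative ring (\<open>divergence_fixpoint_equivariant\<close>).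

  It is bijective because Euler's identity $X_0 \partial_0 P + X_1 \partial_1 P = nP$ on forms of
  degree $n$ allows one to solve for $F$.  Differentiating $g = X_1 F_0 - X_0 F_1$ and eliminating
  one partial derivative by means of $f$ gives
  $$(d+1) F_0 = \partial_1 g + X_0 f, \qquad (d+1) F_1 = X_1 f - \partial_0 g.$$
  Conversely, Euler's identity for $f$ and $g$ shows that the pair so defined is mapped to
  $(f, g)$.  The inverse exists as soon as $d+1$ is invertible (\<open>divergence_fixpoint_iso\<close>),
  which is the case in a field of characteristic zero and therefore in every algebra over it.  The
  formulas have integer coefficients, whence the compatibility with base change
  (\<open>divergence_fixpoint_base_change\<close>).

  The rules of calculus for substitution and formal derivatives are needed over arbitrary
  commutative rings.  Those compatible with products, such as associativity of composition and the
  chain rule, follow by induction over the generators $X_0$, $X_1$ and the constants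
  (\<open>bipoly_induct\<close>); the linear ones, such as Euler's identity, are read off the coefficients.
\<close>

section \<open>Ring homomorphisms and substitution\<close>

lemma ring_hom1D:
  assumes "ring_hom1 h"
  shows "h 1 = 1" "h (x + y) = h x + h y" "h (x * y) = h x * h y"
    "h 0 = 0" "h (- x) = - h x" "h (x - y) = h x - h y"
proof -
  show 1: "h 1 = 1" and 2: "\<And>x y. h (x + y) = h x + h y" and "h (x * y) = h x * h y"
    using assms by (auto simp: ring_hom1_def)
  show 3: "h 0 = 0" using 2[of 0 0] by simp
  show 4: "\<And>x. h (- x) = - h x" using 2 3 by (metis add_eq_0_iff2 add.right_inverse)
  show "h (x - y) = h x - h y" using 2[of x "- y"] 4 by simp
qed

lemma ring_hom1_sum: "ring_hom1 h \<Longrightarrow> h (sum f A) = (\<Sum>x\<in>A. h (f x))"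
  by (induction A rule: infinite_finite_induct) (auto simp: ring_hom1D)

lemma ring_hom1_of_nat: "ring_hom1 h \<Longrightarrow> h (of_nat n) = of_nat n"
  by (induction n) (auto simp: ring_hom1D)

lemma ring_hom1_comp: "ring_hom1 g \<Longrightarrow> ring_hom1 h \<Longrightarrow> ring_hom1 (\<lambda>x. g (h x))"
  by (simp add: ring_hom1_def)

lemma ring_hom1_map_poly:
  assumes h: "ring_hom1 h"
  shows "ring_hom1 (map_poly h)"
  unfolding ring_hom1_def
proof (intro conjI allI)
  show "map_poly h 1 = 1" by (simp add: ring_hom1D[OF h])
  fix p q
  show "map_poly h (p + q) = map_poly h p + map_poly h q"
    by (rule poly_eqI) (simp add: coeff_map_poly ring_hom1D[OF h])
  show "map_poly h (p * q) = map_poly h p * map_poly h q"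
    by (rule poly_eqI) (simp add: coeff_map_poly coeff_mult ring_hom1D[OF h] ring_hom1_sum[OF h])
qed

lemma ring_hom1_poly: "ring_hom1 (\<lambda>p. poly p a)"
  by (simp add: ring_hom1_def)

lemma ring_hom1_const: "ring_hom1 const"
  by (simp add: ring_hom1_def const_def one_pCons)

lemmas const_hom = ring_hom1D[OF ring_hom1_const]

lemma ring_hom1_subst: "ring_hom1 (\<lambda>P. subst P G)"
  unfolding subst_def
  by (intro ring_hom1_comp[OF ring_hom1_poly] ring_hom1_map_poly ring_hom1_const)

lemmas subst_hom = ring_hom1D[OF ring_hom1_subst]

lemma subst_generators:
  "subst (const a) G = const a" "subst X0 G = fst G" "subst X1 G = snd G"
  by (simp_all add: subst_def const_def X0_def X1_def map_poly_pCons const_hom[unfolded const_def]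
      one_pCons[symmetric])

section \<open>Coefficients, monomials and induction\<close>

lemma coeff_const_mult: "coeff (coeff (const a * P) j) i = a * coeff (coeff P j) i"
  by (simp add: const_def)

lemma coeff_X0_mult:
  "coeff (coeff (X0 * P) j) i = (case i of 0 \<Rightarrow> 0 | Suc i \<Rightarrow> coeff (coeff P j) i)"
  by (simp add: X0_def coeff_pCons split: nat.split)

lemma coeff_X1_mult:
  "coeff (coeff (X1 * P) j) i = (case j of 0 \<Rightarrow> 0 | Suc j \<Rightarrow> coeff (coeff P j) i)"
  by (simp add: X1_def coeff_pCons split: nat.split)

lemma bipoly_eqI: "(\<And>i j. coeff (coeff P j) i = coeff (coeff Q j) i) \<Longrightarrow> P = Q"
  by (intro poly_eqI) auto

lemma bimonom: "monom (monom a i) j = const a * X0 ^ i * X1 ^ j"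
proof -
  have "coeff (coeff (X0 ^ i * (X1 ^ j * const a)) j') i' =
      (if i' = i \<and> j' = j then a else 0)" for i' j'
  proof (induction i arbitrary: i')
    case 0
    show ?case
    proof (induction j arbitrary: i' j')
      case 0
      then show ?case by (simp add: const_def coeff_pCons split: nat.split)
    next
      case (Suc j)
      then show ?case by (simp add: coeff_X1_mult mult.assoc split: nat.split)
    qed
  next
    case (Suc i)
    then show ?case by (auto simp: coeff_X0_mult mult.assoc split: nat.split)
  qed
  then show ?thesis
    by (intro bipoly_eqI) (auto simp: mult_ac)
qed

text \<open>
  The expansion behind the two induction rules that follow: one that stays among forms of a fixed
  degree, for linear statements, and one over ring generators, for multiplicative statements.
\<close>

lemma bipoly_eq_sum_monomials:
  "P = (\<Sum>j\<le>degree P. \<Sum>i\<le>degree (coeff P j). const (coeff (coeff P j) i) * X0 ^ i * X1 ^ j)"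
proof -
  have "monom c j = (\<Sum>i\<le>degree c. monom (monom (coeff c i) i) j)" for c :: "'a poly" and j
    by (subst poly_as_sum_of_monoms[symmetric]) (simp add: monom_sum)
  then show ?thesis
    by (subst poly_as_sum_of_monoms[of P, symmetric]) (simp add: bimonom)
qed

lemma binary_forms_induct [consumes 1, case_names zero add monomial]:
  assumes P: "P \<in> binary_forms n"
    and zero: "Q 0"
    and add: "\<And>A B. Q A \<Longrightarrow> Q B \<Longrightarrow> Q (A + B)"
    and monomial: "\<And>a i j. i + j = n \<Longrightarrow> Q (const a * X0 ^ i * X1 ^ j)"
  shows "Q P"
proof -
  have sum: "Q (sum f S)" if "\<And>x. x \<in> S \<Longrightarrow> Q (f x)" for f :: "nat \<Rightarrow> 'a bipoly" and S
    using that by (induction S rule: infinite_finite_induct) (auto intro: zero add)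
  have "Q (const (coeff (coeff P j) i) * X0 ^ i * X1 ^ j)" for i j
    using P zero monomial[of i j] by (cases "coeff (coeff P j) i = 0")
      (auto simp: binary_forms_def const_hom)
  then show ?thesis
    by (subst bipoly_eq_sum_monomials) (intro sum)
qed

lemma bipoly_induct [case_names const X0 X1 add mult]:
  assumes const: "\<And>a. Q (const a)" and X0: "Q X0" and X1: "Q X1"
    and add: "\<And>A B. Q A \<Longrightarrow> Q B \<Longrightarrow> Q (A + B)"
    and mult: "\<And>A B. Q A \<Longrightarrow> Q B \<Longrightarrow> Q (A * B)"
  shows "Q P"
proof -
  have zero: "Q 0" and one: "Q 1" using const[of 0] const[of 1] by (auto simp: const_hom)
  have sum: "Q (sum f S)" if "\<And>x. Q (f x)" for f :: "nat \<Rightarrow> 'a bipoly" and S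
    using that by (induction S rule: infinite_finite_induct) (auto intro: zero add)
  have power: "Q A \<Longrightarrow> Q (A ^ i)" for A i
    by (induction i) (auto intro: one mult)
  show ?thesis
    by (subst bipoly_eq_sum_monomials) (intro sum mult power const X0 X1)
qed

text \<open>
  The uniqueness half of the universal property of a polynomial ring in two variables.  It makes
  composition of polynomial maps associative and unital.
\<close>

lemma ring_hom1_bipoly_eqI:
  assumes "ring_hom1 \<Phi>" "ring_hom1 \<Psi>"
    and "\<And>a. \<Phi> (const a) = \<Psi> (const a)" "\<Phi> X0 = \<Psi> X0" "\<Phi> X1 = \<Psi> X1"
  shows "\<Phi> P = \<Psi> P"
  by (induction P rule: bipoly_induct) (simp_all add: assms ring_hom1D)

lemma subst_assoc: "subst (subst P G) H = subst P (map_comp2 G H)"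
  by (rule ring_hom1_bipoly_eqI[where \<Phi> = "\<lambda>P. subst (subst P G) H"])
    (simp_all add: ring_hom1_subst ring_hom1_comp[OF ring_hom1_subst] subst_generators map_comp2_def)

lemma subst_identity: "subst P (X0, X1) = P"
  by (rule ring_hom1_bipoly_eqI[where \<Phi> = "\<lambda>P. subst P (X0, X1)"])
    (simp_all add: ring_hom1_subst subst_generators, simp add: ring_hom1_def)

lemma map_comp2_assoc: "map_comp2 (map_comp2 F G) H = map_comp2 F (map_comp2 G H)"
  by (simp add: map_comp2_def[of F] map_comp2_def[of "(_, _)"] subst_assoc)

section \<open>Binary forms\<close>

lemma binary_forms_zero: "0 \<in> binary_forms n"
  by (simp add: binary_forms_def)

lemma binary_forms_add: "P \<in> binary_forms n \<Longrightarrow> Q \<in> binary_forms n \<Longrightarrow> P + Q \<in> binary_forms n"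
  by (auto simp: binary_forms_def) (metis add.right_neutral)

lemma binary_forms_diff: "P \<in> binary_forms n \<Longrightarrow> Q \<in> binary_forms n \<Longrightarrow> P - Q \<in> binary_forms n"
  by (auto simp: binary_forms_def) (metis diff_zero)

lemma binary_forms_const_mult: "P \<in> binary_forms n \<Longrightarrow> const a * P \<in> binary_forms n"
  by (auto simp: binary_forms_def coeff_const_mult) (metis mult_zero_right)

lemma binary_forms_X0_mult: "P \<in> binary_forms n \<Longrightarrow> X0 * P \<in> binary_forms (Suc n)"
  by (auto simp: binary_forms_def coeff_X0_mult split: nat.splits)

lemma binary_forms_X1_mult: "P \<in> binary_forms n \<Longrightarrow> X1 * P \<in> binary_forms (Suc n)"
  by (auto simp: binary_forms_def coeff_X1_mult split: nat.splits)

lemma binary_forms_linear_mult: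
  "P \<in> binary_forms n \<Longrightarrow> (const a * X0 + const b * X1) * P \<in> binary_forms (Suc n)"
  by (simp add: distrib_right mult.assoc binary_forms_add binary_forms_const_mult
      binary_forms_X0_mult binary_forms_X1_mult)

lemma form_act_hom:
  "form_act \<gamma> (P + Q) = form_act \<gamma> P + form_act \<gamma> Q"
  "form_act \<gamma> (const a * P) = const a * form_act \<gamma> P"
  by (simp_all add: form_act_def subst_hom subst_generators)

text \<open>
  A linear substitution turns the monomial $X_0^i X_1^j$ into a product of $i + j$ linear forms.
\<close>

lemma form_act_binary_forms:
  assumes "P \<in> binary_forms n"
  shows "form_act \<gamma> P \<in> binary_forms n"
  using assms
proof (induction P rule: binary_forms_induct)
  case zero
  then show ?case by (simp add: form_act_def subst_hom binary_forms_zero)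
next
  case (add A B)
  then show ?case by (simp add: form_act_hom binary_forms_add)
next
  case (monomial a i j)
  let ?G = "linear_map \<gamma>"
  have pow: "subst (P ^ i) ?G = subst P ?G ^ i" for P i
    by (induction i) (auto simp: subst_hom)
  have const: "const a \<in> binary_forms 0"
    by (auto simp: binary_forms_def const_def coeff_pCons split: nat.splits)
  have L0: "fst ?G ^ i * P \<in> binary_forms (i + n)" if "P \<in> binary_forms n" for P n i
    using that by (induction i) (auto simp: linear_map_def mult.assoc binary_forms_linear_mult)
  have L1: "snd ?G ^ i * P \<in> binary_forms (i + n)" if "P \<in> binary_forms n" for P n i
    using that by (induction i) (auto simp: linear_map_def mult.assoc binary_forms_linear_mult)
  have "fst ?G ^ i * (snd ?G ^ j * const a) \<in> binary_forms (i + (j + 0))"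
    by (intro L0 L1 const)
  also have "fst ?G ^ i * (snd ?G ^ j * const a) = form_act \<gamma> (const a * X0 ^ i * X1 ^ j)"
    by (simp add: form_act_def subst_hom pow subst_generators mult_ac)
  finally show ?case using monomial by simp
qed

section \<open>Formal derivatives\<close>

lemma coeff_formal_deriv: "coeff (formal_deriv p) i = of_nat (Suc i) * coeff p (Suc i)"
proof -
  have "coeff (formal_deriv p) i =
      (\<Sum>k\<le>degree p. if k = Suc i then of_nat (Suc i) * coeff p (Suc i) else 0)"
    unfolding formal_deriv_def coeff_sum
  proof (rule sum.cong)
    fix k
    \<comment> \<open>The summand \<open>k = 0\<close> also lands in degree \<open>0\<close>, with coefficient \<open>0\<close>.\<close>
    show "coeff (monom (of_nat k * coeff p k) (k - 1)) i =
        (if k = Suc i then of_nat (Suc i) * coeff p (Suc i) else 0)"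
      by (cases k) auto
  qed simp
  also have "\<dots> = of_nat (Suc i) * coeff p (Suc i)"
    by (simp add: coeff_eq_0)
  finally show ?thesis .
qed

lemma formal_deriv_add: "formal_deriv (p + q) = formal_deriv p + formal_deriv q"
  by (rule poly_eqI) (simp only: coeff_formal_deriv coeff_add distrib_left)

lemma formal_deriv_0: "formal_deriv 0 = 0"
  by (simp add: formal_deriv_def)

lemma formal_deriv_pCons: "formal_deriv (pCons a p) = p + pCons 0 (formal_deriv p)"
  by (rule poly_eqI) (simp add: coeff_formal_deriv coeff_pCons algebra_simps split: nat.split)

lemma formal_deriv_smult: "formal_deriv (smult a p) = smult a (formal_deriv p)"
  by (rule poly_eqI) (simp only: coeff_formal_deriv coeff_smult mult_ac)

lemma formal_deriv_mult: "formal_deriv (p * q) = formal_deriv p * q + p * formal_deriv q"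
proof (induction p)
  case 0
  then show ?case by (simp add: formal_deriv_0)
next
  case (pCons a p)
  have "formal_deriv (pCons a p * q) = smult a (formal_deriv q) + formal_deriv (pCons 0 (p * q))"
    by (simp add: formal_deriv_add formal_deriv_smult)
  also have "formal_deriv (pCons 0 (p * q)) =
      p * q + pCons 0 (formal_deriv p * q) + pCons 0 (p * formal_deriv q)"
    by (simp only: formal_deriv_pCons pCons add_pCons[symmetric] add.assoc add_0_left)
      (metis add_pCons add_0_left)
  finally show ?case
    by (simp add: formal_deriv_pCons algebra_simps)
qed

lemma coeff_partial0: "coeff (coeff (partial0 P) j) i = of_nat (Suc i) * coeff (coeff P j) (Suc i)"
  by (simp only: partial0_def coeff_map_poly[where f = formal_deriv, OF formal_deriv_0] coeff_formal_deriv)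

lemma coeff_partial1: "coeff (coeff (partial1 P) j) i = of_nat (Suc j) * coeff (coeff P (Suc j)) i"
proof -
  have "coeff (of_nat m * p) i = of_nat m * coeff p i" for m and p :: "'a poly"
    by (induction m) (auto simp: algebra_simps)
  then show ?thesis by (simp only: partial1_def coeff_formal_deriv)
qed

definition derivation :: "('a::comm_ring_1 bipoly \<Rightarrow> 'a bipoly) \<Rightarrow> bool" where
  "derivation D \<longleftrightarrow> (\<forall>P Q. D (P + Q) = D P + D Q) \<and> (\<forall>P Q. D (P * Q) = D P * Q + P * D Q) \<and>
     (\<forall>a. D (const a) = 0)"

lemma derivationD:
  assumes "derivation D"
  shows "D (P + Q) = D P + D Q" "D (P * Q) = D P * Q + P * D Q" "D (const a) = 0"
    "D (P - Q) = D P - D Q"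
proof -
  show add: "D (P + Q) = D P + D Q" for P Q using assms by (simp add: derivation_def)
  show "D (P * Q) = D P * Q + P * D Q" "D (const a) = 0" using assms by (simp_all add: derivation_def)
  show "D (P - Q) = D P - D Q" using add[of "P - Q" Q] by simp
qed

lemma derivation_partial0: "derivation partial0"
  unfolding derivation_def
proof (intro conjI allI)
  fix P Q :: "'a bipoly" and a :: 'a
  have sum: "formal_deriv (sum f A) = (\<Sum>x\<in>A. formal_deriv (f x))"
    for f :: "nat \<Rightarrow> 'a poly" and A
    by (induction A rule: infinite_finite_induct) (simp_all add: formal_deriv_0 formal_deriv_add)
  show "partial0 (P + Q) = partial0 P + partial0 Q"
    by (rule poly_eqI) (simp add: partial0_def coeff_map_poly formal_deriv_0 formal_deriv_add)
  show "partial0 (P * Q) = partial0 P * Q + P * partial0 Q"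
    by (rule poly_eqI) (simp add: partial0_def coeff_map_poly formal_deriv_0 coeff_mult sum
        formal_deriv_mult sum.distrib)
  show "partial0 (const a) = 0"
    by (simp add: partial0_def const_def map_poly_pCons formal_deriv_0 formal_deriv_pCons)
qed

lemma derivation_partial1: "derivation partial1"
  by (simp add: derivation_def partial1_def formal_deriv_add formal_deriv_mult const_def
      formal_deriv_pCons formal_deriv_0)

lemmas partial_rules = derivationD[OF derivation_partial0] derivationD[OF derivation_partial1]

lemma partial_generators:
  "partial0 X0 = 1" "partial0 X1 = 0" "partial1 X0 = 0" "partial1 X1 = 1"
  by (simp_all add: partial0_def partial1_def X0_def X1_def map_poly_pCons formal_deriv_0
      formal_deriv_pCons one_pCons)

text \<open>
  Both sides are additive in $P$ and satisfy the same Leibniz rule over the substitution, so it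
  suffices to compare them on the generators.  Taking an arbitrary derivation treats both partial
  derivatives at once.
\<close>

lemma chain_rule:
  assumes "derivation D"
  shows "D (subst P G) = subst (partial0 P) G * D (fst G) + subst (partial1 P) G * D (snd G)"
  by (induction P rule: bipoly_induct)
    (simp_all add: derivationD[OF assms] partial_rules partial_generators subst_generators
      subst_hom algebra_simps)

lemma partial_commute: "partial0 (partial1 P) = partial1 (partial0 P)"
  by (rule bipoly_eqI) (simp only: coeff_partial0 coeff_partial1 mult_ac)

text \<open>
  The operator on the left multiplies the monomial $X_0^i X_1^j$ by $i + j$.
\<close>

lemma euler_identity:
  assumes "P \<in> binary_forms n"
  shows "X0 * partial0 P + X1 * partial1 P = const (of_nat n) * P"
proof (rule bipoly_eqI)
  fix i j
  have "of_nat (i + j) * coeff (coeff P j) i = of_nat n * coeff (coeff P j) i"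
    using assms by (cases "coeff (coeff P j) i = 0") (auto simp: binary_forms_def)
  then show "coeff (coeff (X0 * partial0 P + X1 * partial1 P) j) i
      = coeff (coeff (const (of_nat n) * P) j) i"
    unfolding coeff_const_mult coeff_add coeff_X0_mult coeff_X1_mult coeff_partial0 coeff_partial1
    by (cases i; cases j; simp add: algebra_simps)
qed

lemma partial0_binary_forms: "P \<in> binary_forms (Suc n) \<Longrightarrow> partial0 P \<in> binary_forms n"
  unfolding binary_forms_def mem_Collect_eq coeff_partial0
  by (metis add_Suc mult_zero_right nat.inject)

lemma partial1_binary_forms: "P \<in> binary_forms (Suc n) \<Longrightarrow> partial1 P \<in> binary_forms n"
  unfolding binary_forms_def mem_Collect_eq coeff_partial1
  by (metis add_Suc_right mult_zero_right nat.inject)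

section \<open>The modules\<close>

definition adjugate2 :: "'a::comm_ring_1^2^2 \<Rightarrow> 'a^2^2" where
  "adjugate2 \<gamma> = vector [vector [\<gamma>$2$2, - (\<gamma>$1$2)], vector [- (\<gamma>$2$1), \<gamma>$1$1]]"

lemma adjugate2_nth:
  "adjugate2 \<gamma> $1$1 = \<gamma>$2$2" "adjugate2 \<gamma> $1$2 = - (\<gamma>$1$2)"
  "adjugate2 \<gamma> $2$1 = - (\<gamma>$2$1)" "adjugate2 \<gamma> $2$2 = \<gamma>$1$1"
  by (simp_all add: adjugate2_def)

lemma matrix_inv_eqI:
  fixes A B :: "'a::semiring_1^'n^'n"
  assumes "A ** B = mat 1" "B ** A = mat 1"
  shows "matrix_inv A = B"
proof -
  have "A ** matrix_inv A = mat 1 \<and> matrix_inv A ** A = mat 1"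
    unfolding matrix_inv_def using assms by (rule_tac someI[where x = B]) simp
  then have "matrix_inv A = matrix_inv A ** (A ** B)" "(matrix_inv A ** A) ** B = B"
    using assms by simp_all
  then show ?thesis by (simp add: matrix_mul_assoc)
qed

lemma adjugate2_inverse:
  assumes "\<gamma> \<in> SL2"
  shows "\<gamma> ** adjugate2 \<gamma> = mat 1" "adjugate2 \<gamma> ** \<gamma> = mat 1"
  using assms by (simp_all add: SL2_def det_2 vec_eq_iff forall_2 matrix_matrix_mult_def sum_2
      adjugate2_nth mat_def algebra_simps)

text \<open>
  Replacing the inverse by the adjugate gives entries that are polynomial in those of $\gamma$, so
  that identities for the action on pairs become ring identities.
\<close>

lemma matrix_inv_SL2: "\<gamma> \<in> SL2 \<Longrightarrow> matrix_inv \<gamma> = adjugate2 \<gamma>"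
  by (intro matrix_inv_eqI adjugate2_inverse)

lemma SL2_mult: "\<gamma> \<in> SL2 \<Longrightarrow> \<delta> \<in> SL2 \<Longrightarrow> \<gamma> ** \<delta> \<in> SL2"
  by (simp add: SL2_def det_mul)

lemma matrix_inv_mult_SL2:
  assumes "\<gamma> \<in> SL2" "\<delta> \<in> SL2"
  shows "matrix_inv (\<gamma> ** \<delta>) = matrix_inv \<delta> ** matrix_inv \<gamma>"
  using assms by (simp add: matrix_inv_SL2 SL2_mult, simp add: vec_eq_iff forall_2
      matrix_matrix_mult_def sum_2 adjugate2_nth algebra_simps)

lemma linear_map_mult: "linear_map (\<gamma> ** \<delta>) = map_comp2 (linear_map \<gamma>) (linear_map \<delta>)"
  by (simp add: linear_map_def map_comp2_def subst_hom subst_generators matrix_matrix_mult_def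
      sum_2 const_hom algebra_simps)

lemma linear_map_one: "linear_map (mat 1) = (X0, X1)"
  by (simp add: linear_map_def mat_def const_hom)

lemma form_act_one: "form_act (mat 1) P = P"
  by (simp add: form_act_def linear_map_one subst_identity)

lemma form_act_mult: "form_act (\<gamma> ** \<delta>) P = form_act \<delta> (form_act \<gamma> P)"
  by (simp add: form_act_def linear_map_mult subst_assoc)

text \<open>
  Outer composition with a linear map only forms linear combinations, so conjugation acts on each
  component by substitution and mixes the two components by the entries of $\gamma^{-1}$.
\<close>

lemma conj_act_Pair:
  "conj_act \<gamma> (F0, F1) =
     (const (matrix_inv \<gamma> $1$1) * form_act \<gamma> F0 + const (matrix_inv \<gamma> $1$2) * form_act \<gamma> F1,
      const (matrix_inv \<gamma> $2$1) * form_act \<gamma> F0 + const (matrix_inv \<gamma> $2$2) * form_act \<gamma> F1)"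
  by (simp add: conj_act_def map_comp2_def linear_map_def[of "matrix_inv \<gamma>"] subst_hom
      subst_generators form_act_def)

lemma conj_act_one: "conj_act (mat 1) F = F"
proof -
  have "matrix_inv (mat 1 :: 'a^2^2) = mat 1" by (rule matrix_inv_eqI) simp_all
  moreover have "(mat 1 :: 'a^2^2)$1$1 = 1" "(mat 1 :: 'a^2^2)$1$2 = 0"
    "(mat 1 :: 'a^2^2)$2$1 = 0" "(mat 1 :: 'a^2^2)$2$2 = 1"
    by (simp_all add: mat_def)
  ultimately show ?thesis by (cases F) (simp add: conj_act_Pair form_act_one const_hom)
qed

lemma conj_act_mult:
  "\<gamma> \<in> SL2 \<Longrightarrow> \<delta> \<in> SL2 \<Longrightarrow> conj_act (\<gamma> ** \<delta>) F = conj_act \<delta> (conj_act \<gamma> F)"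
  by (simp add: conj_act_def matrix_inv_mult_SL2 linear_map_mult map_comp2_assoc)

lemma module_pair_scale: "module pair_scale"
  by unfold_locales (auto simp: pair_scale_def const_hom algebra_simps)

lemma subspace_binary_forms_prod:
  "module.subspace pair_scale (binary_forms m \<times> binary_forms n)"
  by (auto simp: module.subspace_def[OF module_pair_scale] pair_scale_def zero_prod_def
      binary_forms_zero binary_forms_add binary_forms_const_mult)

lemma SL2_module_W: "SL2_module pair_scale (W d) conj_act"
  unfolding SL2_module_def
proof (intro conjI ballI allI)
  show "module.subspace pair_scale (W d)"
    by (simp add: W_def subspace_binary_forms_prod)
qed (auto simp: module_pair_scale W_def conj_act_Pair pair_scale_def form_act_hom
    distrib_left mult.left_commute add_ac
    conj_act_one conj_act_mult
    intro!: binary_forms_add binary_forms_const_mult form_act_binary_forms)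

lemma SL2_module_S_sum: "SL2_module pair_scale (S_sum d) sum_act"
  unfolding SL2_module_def
proof (intro conjI ballI allI)
  show "module.subspace pair_scale (S_sum d)"
    by (simp add: S_sum_def subspace_binary_forms_prod)
qed (auto simp: module_pair_scale S_sum_def sum_act_def pair_scale_def form_act_hom
    form_act_one form_act_mult intro!: form_act_binary_forms)

section \<open>The isomorphism\<close>

definition divergence_fixpoint :: "'a::comm_ring_1 bipoly \<times> 'a bipoly \<Rightarrow> 'a bipoly \<times> 'a bipoly" where
  "divergence_fixpoint F = (partial0 (fst F) + partial1 (snd F), X1 * fst F - X0 * snd F)"

text \<open>
  With $\gamma$ having rows $(a, b)$ and $(c, d)$, the divergence of the conjugated pair comes out
  as $(ad - bc)$ times the transformed divergence: the mixed terms $\partial_1 F_0$ and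
  $\partial_0 F_1$ cancel, as they do in the trace of a conjugated matrix.  In the fixed point
  polynomial the coefficients collect to $(cX_0 + dX_1) \cdot (F_0 \circ \gamma) - (aX_0 + bX_1)
  \cdot (F_1 \circ \gamma)$, which is the substitution of $\gamma$ into $X_1 F_0 - X_0 F_1$.
\<close>

lemma divergence_fixpoint_equivariant:
  assumes "\<gamma> \<in> SL2"
  shows "divergence_fixpoint (conj_act \<gamma> F) = sum_act \<gamma> (divergence_fixpoint F)"
proof -
  obtain F0 F1 where F: "F = (F0, F1)" by (cases F)
  define a b c d where entries: "a = const (\<gamma>$1$1)" "b = const (\<gamma>$1$2)"
    "c = const (\<gamma>$2$1)" "d = const (\<gamma>$2$2)"
  have det: "a * d - b * c = 1"
    using assms by (simp add: entries SL2_def det_2 const_hom(1) const_hom(3,6)[symmetric])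
  have conj: "conj_act \<gamma> F =
      (d * form_act \<gamma> F0 - b * form_act \<gamma> F1, a * form_act \<gamma> F1 - c * form_act \<gamma> F0)"
    using assms by (simp add: F conj_act_Pair matrix_inv_SL2 adjugate2_nth entries const_hom)
  have L: "linear_map \<gamma> = (a * X0 + b * X1, c * X0 + d * X1)"
    by (simp add: linear_map_def entries)
  have entry_deriv: "partial0 a = 0" "partial0 b = 0" "partial0 c = 0" "partial0 d = 0"
    "partial1 a = 0" "partial1 b = 0" "partial1 c = 0" "partial1 d = 0"
    by (simp_all add: entries partial_rules)
  have chain: "partial0 (form_act \<gamma> P) = form_act \<gamma> (partial0 P) * a + form_act \<gamma> (partial1 P) * c"
    "partial1 (form_act \<gamma> P) = form_act \<gamma> (partial0 P) * b + form_act \<gamma> (partial1 P) * d" for P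
    by (simp_all add: form_act_def chain_rule[OF derivation_partial0]
        chain_rule[OF derivation_partial1] L partial_rules entry_deriv partial_generators)
  let ?A = "form_act \<gamma> (partial0 F0)" and ?B = "form_act \<gamma> (partial1 F1)"
  have "fst (divergence_fixpoint (conj_act \<gamma> F)) = (a * d - b * c) * (?A + ?B)"
    by (simp add: divergence_fixpoint_def conj partial_rules entry_deriv chain algebra_simps)
  moreover have "snd (divergence_fixpoint (conj_act \<gamma> F)) = form_act \<gamma> (X1 * F0 - X0 * F1)"
    by (simp add: divergence_fixpoint_def conj form_act_def subst_hom subst_generators L
        algebra_simps)
  ultimately show ?thesis
    by (simp add: det F sum_act_def divergence_fixpoint_def prod_eq_iff form_act_hom)
qed

text \<open>
  The parameter \<open>u\<close> stands for the inverse of $d + 1$ in the ring.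
\<close>

definition divergence_fixpoint_inverse ::
  "'a::comm_ring_1 \<Rightarrow> 'a bipoly \<times> 'a bipoly \<Rightarrow> 'a bipoly \<times> 'a bipoly" where
  "divergence_fixpoint_inverse u p =
     (const u * (partial1 (snd p) + X0 * fst p), const u * (X1 * fst p - partial0 (snd p)))"

text \<open>
  Substituting the definitions of $f$ and $g$ into the inverse leaves $F_i$ plus the Euler operator
  applied to $F_i$, that is, $(1 + d) F_i$, before the division by $d + 1$.
\<close>

lemma divergence_fixpoint_left_inverse:
  assumes u: "of_nat (Suc d) * u = 1" and F: "F \<in> W d"
  shows "divergence_fixpoint_inverse u (divergence_fixpoint F) = F"
proof -
  obtain F0 F1 where [simp]: "F = (F0, F1)" by (cases F)
  have euler: "X0 * partial0 P + X1 * partial1 P = const (of_nat d) * P" if "P = F0 \<or> P = F1" for P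
    using F that by (auto simp: W_def intro: euler_identity)
  have unit: "const u * (P + const (of_nat d) * P) = P" for P
  proof -
    have "const u * (P + const (of_nat d) * P) = const (of_nat (Suc d) * u) * P"
      by (simp add: const_hom algebra_simps)
    then show ?thesis by (simp only: u const_hom mult_1)
  qed
  have "partial1 (X1 * F0 - X0 * F1) + X0 * (partial0 F0 + partial1 F1)
      = F0 + (X0 * partial0 F0 + X1 * partial1 F0)"
    by (simp add: partial_rules partial_generators algebra_simps)
  moreover have "X1 * (partial0 F0 + partial1 F1) - partial0 (X1 * F0 - X0 * F1)
      = F1 + (X0 * partial0 F1 + X1 * partial1 F1)"
    by (simp add: partial_rules partial_generators algebra_simps)
  ultimately show ?thesis
    by (simp add: divergence_fixpoint_inverse_def divergence_fixpoint_def euler unit)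
qed

text \<open>
  The factor $d + 1$ arises in two ways: for $g$ it is the degree in Euler's identity, and for $f$ it
  is that degree $d - 1$ plus $2$, the divergence of the identity map $(X_0, X_1)$.  The second
  derivatives of $g$ cancel by symmetry.
\<close>

lemma divergence_fixpoint_right_inverse:
  assumes u: "of_nat (Suc d) * u = 1" and "d \<ge> 1" and p: "p \<in> S_sum d"
  shows "divergence_fixpoint (divergence_fixpoint_inverse u p) = p"
proof -
  obtain f g where [simp]: "p = (f, g)" by (cases p)
  have f: "X0 * partial0 f + X1 * partial1 f = const (of_nat (d - 1)) * f"
    and g: "X0 * partial0 g + X1 * partial1 g = const (of_nat (Suc d)) * g"
    using p by (auto simp: S_sum_def intro: euler_identity simp del: of_nat_Suc)
  have unit: "const u * (const (of_nat (Suc d)) * P) = P" for P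
    using u by (metis const_hom(1,3) mult.assoc mult.commute mult_1)
  have "partial0 (const u * (partial1 g + X0 * f)) + partial1 (const u * (X1 * f - partial0 g))
      = const u * (f + f + (X0 * partial0 f + X1 * partial1 f))"
    by (simp add: partial_rules partial_generators partial_commute algebra_simps)
  also have "f + f + (X0 * partial0 f + X1 * partial1 f) = const (of_nat (Suc d)) * f"
  proof -
    have "Suc d = 1 + 1 + (d - 1)" using \<open>d \<ge> 1\<close> by simp
    then have "of_nat (Suc d) = (1 + 1 + of_nat (d - 1) :: 'a)" by (metis of_nat_1 of_nat_add)
    then show ?thesis by (simp only: f const_hom distrib_right mult_1)
  qed
  finally have 1: "partial0 (const u * (partial1 g + X0 * f))
      + partial1 (const u * (X1 * f - partial0 g)) = f"
    by (simp only: unit)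
  have "X1 * (const u * (partial1 g + X0 * f)) - X0 * (const u * (X1 * f - partial0 g))
      = const u * (X0 * partial0 g + X1 * partial1 g)"
    by (simp add: algebra_simps)
  then have 2: "X1 * (const u * (partial1 g + X0 * f)) - X0 * (const u * (X1 * f - partial0 g)) = g"
    by (simp only: g unit)
  show ?thesis
    by (simp add: divergence_fixpoint_inverse_def divergence_fixpoint_def 1 2)
qed

lemma divergence_fixpoint_iso:
  fixes u :: "'a::comm_ring_1"
  assumes "d \<ge> 1" and u: "of_nat (Suc d) * u = 1"
  shows "SL2_module_iso pair_scale (W d) conj_act pair_scale (S_sum d) sum_act
    (divergence_fixpoint :: 'a bipoly \<times> 'a bipoly \<Rightarrow> _)"
  unfolding SL2_module_iso_def
proof (intro conjI ballI allI)
  have d: "Suc (d - 1) = d" using assms(1) by simp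
  show "bij_betw divergence_fixpoint (W d) (S_sum d :: ('a bipoly \<times> 'a bipoly) set)"
  proof (rule bij_betw_byWitness[where f' = "divergence_fixpoint_inverse u"])
    show "\<forall>F\<in>W d. divergence_fixpoint_inverse u (divergence_fixpoint F) = F"
      using divergence_fixpoint_left_inverse[OF u] by blast
    show "\<forall>p\<in>S_sum d. divergence_fixpoint (divergence_fixpoint_inverse u p) = p"
      using divergence_fixpoint_right_inverse[OF u assms(1)] by blast
    show "divergence_fixpoint ` W d \<subseteq> (S_sum d :: ('a bipoly \<times> 'a bipoly) set)"
      using partial0_binary_forms[where n = "d - 1", unfolded d] partial1_binary_forms[where n = "d - 1", unfolded d]
      by (auto simp: W_def S_sum_def divergence_fixpoint_def d
          intro!: binary_forms_add binary_forms_diff binary_forms_X0_mult binary_forms_X1_mult)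
    show "divergence_fixpoint_inverse u ` S_sum d \<subseteq> (W d :: ('a bipoly \<times> 'a bipoly) set)"
      using binary_forms_X0_mult[where n = "d - 1", unfolded d] binary_forms_X1_mult[where n = "d - 1", unfolded d]
      by (auto simp: W_def S_sum_def divergence_fixpoint_inverse_def d
          intro!: binary_forms_const_mult binary_forms_add binary_forms_diff
            partial0_binary_forms partial1_binary_forms)
  qed
qed (simp_all add: SL2_module_W SL2_module_S_sum divergence_fixpoint_equivariant,
  auto simp: divergence_fixpoint_def pair_scale_def partial_rules algebra_simps)

lemma divergence_fixpoint_base_change:
  assumes h: "ring_hom1 h"
  shows "divergence_fixpoint (base_change h F) = base_change h (divergence_fixpoint F)"
proof -
  let ?H = "map_poly (map_poly h)"
  note H = ring_hom1_map_poly[OF ring_hom1_map_poly[OF h]]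
  have coeff: "coeff (coeff (?H P) j) i = h (coeff (coeff P j) i)" for P i j
    by (simp add: coeff_map_poly ring_hom1D[OF h])
  have "partial0 (?H P) = ?H (partial0 P)" "partial1 (?H P) = ?H (partial1 P)" for P
    by (rule bipoly_eqI, simp only: coeff coeff_partial0 coeff_partial1 ring_hom1D[OF h]
        ring_hom1_of_nat[OF h])+
  moreover have "?H X0 = X0" "?H X1 = X1"
    by (simp_all add: X0_def X1_def map_poly_pCons ring_hom1D[OF h])
  ultimately show ?thesis
    by (simp add: divergence_fixpoint_def base_change_def ring_hom1D[OF H])
qed

theorem proposition2p1:
  fixes d :: nat and h :: "'k::field_char_0 \<Rightarrow> 'r::comm_ring_1"
  assumes "d \<ge> 2" and "ring_hom1 h"
  shows "\<exists>(\<alpha> :: 'k bipoly \<times> 'k bipoly \<Rightarrow> 'k bipoly \<times> 'k bipoly)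
          (\<beta> :: 'r bipoly \<times> 'r bipoly \<Rightarrow> 'r bipoly \<times> 'r bipoly).
     SL2_module_iso pair_scale (W d) conj_act pair_scale (S_sum d) sum_act \<alpha> \<and>
     (\<forall>F0 F1. (F0, F1) \<in> W d \<longrightarrow>
        \<alpha> (F0, F1) = (partial0 F0 + partial1 F1, X1 * F0 - X0 * F1)) \<and>
     SL2_module_iso pair_scale (W d) conj_act pair_scale (S_sum d) sum_act \<beta> \<and>
     (\<forall>F0 F1. (F0, F1) \<in> W d \<longrightarrow>
        \<beta> (F0, F1) = (partial0 F0 + partial1 F1, X1 * F0 - X0 * F1)) \<and>
     (\<forall>F\<in>W d. \<beta> (base_change h F) = base_change h (\<alpha> F))"
proof -
  let ?u = "inverse (of_nat (Suc d)) :: 'k"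
  have d: "d \<ge> 1" using assms(1) by simp
  have k: "of_nat (Suc d) * ?u = 1" by (rule right_inverse) (simp del: of_nat_Suc)
  then have r: "of_nat (Suc d) * h ?u = 1"
    by (metis ring_hom1D(1,3)[OF assms(2)] ring_hom1_of_nat[OF assms(2)])
  show ?thesis
    by (intro exI[of _ divergence_fixpoint] conjI divergence_fixpoint_iso[OF d k]
        divergence_fixpoint_iso[OF d r])
      (simp_all add: divergence_fixpoint_base_change[OF assms(2)], simp_all add: divergence_fixpoint_def)
qed

end
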